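(* Let $Y$ be a simple positively weighted graph on $n$ vertices, and let $u,v$ be the apexes of the disconnected double cone $O_2\vee Y$. For every integer $k>0$ such that $(n+2)\nmid 2k$, proper Laplacian $(e^{i\zeta_k}\cos\gamma_k,\ ie^{i\zeta_k}\sin\gamma_k)$-fractional revival occurs between $u$ and $v$ at time $\tau_k$, where $\tau_k=\gamma_k=\frac{2k\pi}{n+2}$ and $\zeta_k=\frac{2k(n+1)\pi}{n+2}$. Moreover: (1) if $n$ is odd or $n\equiv 0\pmod 4$, then neither Laplacian perfect state transfer nor balanced Laplacian fractional revival occurs between $u$ and $v$; (2) if $n\equiv 2\pmod 4$, then Laplacian perfect state transfer occurs between $u$ and $v$ with minimum (positive) time $\frac{\pi}{2}$, and balanced Laplacian fractional revival occurs between $u$ and $v$ if and only if $\nu_2(n+2)\geq 3$.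
   Context: All graphs are weighted undirected graphs; $\omega_{a,b}$ denotes the weight of edge $(a,b)$. The join $X\vee Y$ of two weighted graphs is obtained from their disjoint union by joining every vertex of $X$ to every vertex of $Y$ by an edge of weight one. $O_2$ is the graph on two vertices with no edges; in $O_2\vee Y$ the two vertices of $O_2$ are the apexes. The Laplacian is $L=D-A$, where $A$ is the weighted adjacency matrix and $D$ is the diagonal matrix of weighted degrees $\deg(a)=\sum_{b\neq a}\omega_{a,b}$ (no loops here). $U(t)=e^{itL}$, $\mathbf e_a$ is the standard basis vector of vertex $a$. $(\alpha,\beta)$-fractional revival occurs between $u$ and $v$ at time $\tau$ if $U(\tau)\mathbf e_u=\alpha\mathbf e_u+\beta\mathbf e_v$ with $\alpha,\beta\in\mathbb C$; it is proper if $\beta\ne0$ and balanced if $|\alpha|=|\beta|$. Perfect state transfer occurs between $u$ and $v$ at time $\tau$ if $|U(\tau)_{u,v}|=1$. For a nonzero integer $b$, $\nu_2(b)$ denotes the exponent of the largest power of $2$ dividing $b$. *)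

theory Defs
  imports "HOL-Analysis.Analysis" "HOL-Computational_Algebra.Primes"
begin

text \<open>A weighted graph with vertex set \<open>UNIV\<close> is given by its weight function;
  \<open>(a, b)\<close> is an edge iff \<open>\<omega> a b\<close> is nonzero.\<close>

type_synonym 'v wgraph = "'v \<Rightarrow> 'v \<Rightarrow> real"

definition is_edge :: "'v wgraph \<Rightarrow> 'v \<Rightarrow> 'v \<Rightarrow> bool" where
  "is_edge \<omega> a b \<longleftrightarrow> \<omega> a b \<noteq> 0"

definition undirected :: "'v wgraph \<Rightarrow> bool" where
  "undirected \<omega> \<longleftrightarrow> (\<forall>a b. \<omega> a b = \<omega> b a)"

definition simple :: "'v wgraph \<Rightarrow> bool" where
  "simple \<omega> \<longleftrightarrow> (\<forall>a. \<not> is_edge \<omega> a a)"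

definition positively_weighted :: "'v wgraph \<Rightarrow> bool" where
  "positively_weighted \<omega> \<longleftrightarrow> (\<forall>a b. is_edge \<omega> a b \<longrightarrow> \<omega> a b > 0)"

fun graph_join :: "'a wgraph \<Rightarrow> 'b wgraph \<Rightarrow> ('a + 'b) wgraph" where
  "graph_join X Y (Inl a) (Inl b) = X a b"
| "graph_join X Y (Inr a) (Inr b) = Y a b"
| "graph_join X Y (Inl a) (Inr b) = 1"
| "graph_join X Y (Inr a) (Inl b) = 1"

definition O2 :: "bool wgraph" where
  "O2 = (\<lambda>a b. 0)"

definition adjacency_matrix :: "'v::finite wgraph \<Rightarrow> real^'v^'v" where
  "adjacency_matrix \<omega> = (\<chi> a b. \<omega> a b)"

definition degree_matrix :: "'v::finite wgraph \<Rightarrow> real^'v^'v" where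
  "degree_matrix \<omega> = (\<chi> a b. if a = b then (\<Sum>c\<in>UNIV - {a}. \<omega> a c) else 0)"

definition laplacian :: "'v::finite wgraph \<Rightarrow> real^'v^'v" where
  "laplacian \<omega> = degree_matrix \<omega> - adjacency_matrix \<omega>"

primrec matrix_power :: "complex^'v^'v \<Rightarrow> nat \<Rightarrow> complex^'v^'v" where
  "matrix_power M 0 = mat 1"
| "matrix_power M (Suc k) = M ** matrix_power M k"

text \<open>The type of square matrices is not an instance of \<open>real_normed_algebra_1\<close>, so the
  library function \<open>exp\<close> does not apply to it.\<close>

definition matrix_exp :: "complex^'v^'v \<Rightarrow> complex^'v^'v" where
  "matrix_exp M = (\<Sum>k. (1 / fact k) *\<^sub>R matrix_power M k)"

definition transition_matrix :: "'v::finite wgraph \<Rightarrow> real \<Rightarrow> complex^'v^'v" where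
  "transition_matrix \<omega> t =
     matrix_exp (\<chi> a b. \<i> * complex_of_real t * complex_of_real (laplacian \<omega> $ a $ b))"

definition fractional_revival ::
    "'v::finite wgraph \<Rightarrow> complex \<Rightarrow> complex \<Rightarrow> 'v \<Rightarrow> 'v \<Rightarrow> real \<Rightarrow> bool" where
  "fractional_revival \<omega> \<alpha> \<beta> u v \<tau> \<longleftrightarrow>
     transition_matrix \<omega> \<tau> *v axis u 1 = \<alpha> *s axis u 1 + \<beta> *s axis v 1"

definition proper_fractional_revival ::
    "'v::finite wgraph \<Rightarrow> complex \<Rightarrow> complex \<Rightarrow> 'v \<Rightarrow> 'v \<Rightarrow> real \<Rightarrow> bool" where
  "proper_fractional_revival \<omega> \<alpha> \<beta> u v \<tau> \<longleftrightarrow>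
     fractional_revival \<omega> \<alpha> \<beta> u v \<tau> \<and> \<beta> \<noteq> 0"

definition balanced_fractional_revival ::
    "'v::finite wgraph \<Rightarrow> 'v \<Rightarrow> 'v \<Rightarrow> real \<Rightarrow> bool" where
  "balanced_fractional_revival \<omega> u v \<tau> \<longleftrightarrow>
     (\<exists>\<alpha> \<beta>. fractional_revival \<omega> \<alpha> \<beta> u v \<tau> \<and> norm \<alpha> = norm \<beta>)"

definition perfect_state_transfer :: "'v::finite wgraph \<Rightarrow> 'v \<Rightarrow> 'v \<Rightarrow> real \<Rightarrow> bool" where
  "perfect_state_transfer \<omega> u v \<tau> \<longleftrightarrow> norm (transition_matrix \<omega> \<tau> $ u $ v) = 1"

end

theory Submission imports Defs begin

text \<open>The all-ones vector, \<open>e\<^sub>u - e\<^sub>v\<close> and \<open>n (e\<^sub>u + e\<^sub>v) - 2 \<cdot> 1\<^sub>Y\<close> are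
  Laplacian eigenvectors of the double cone for the eigenvalues \<open>0\<close>, \<open>n\<close>, \<open>n + 2\<close>, and they span
  \<open>e\<^sub>u\<close>. Hence, with \<open>q = e\<^sup>i\<^sup>t\<close>, the column \<open>U(t) e\<^sub>u\<close> is an explicit expression in \<open>q\<^sup>n\<close> and
  \<open>q\<^sup>n\<^sup>+\<^sup>2\<close>, and the revival properties become polynomial equations in \<open>q\<close>: fractional revival
  means \<open>q\<^sup>n\<^sup>+\<^sup>2 = 1\<close>, perfect state transfer adds \<open>q\<^sup>2 = -1\<close>, and balancedness adds
  \<open>q\<^sup>4 = -1\<close>. Comparing 2-adic valuations, these are solvable iff \<open>4\<close>, respectively
  \<open>8\<close>, divides \<open>n + 2\<close>.\<close>

section \<open>Convergence of the matrix exponential and its action on eigenvectors\<close>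

lemma norm_vec_le_sum: "norm x \<le> (\<Sum>i\<in>UNIV. norm (x $ i))"
  unfolding norm_vec_def by (rule L2_set_le_sum) simp

lemma norm_matrix_power_entry_le:
  fixes M :: "complex^'v^'v"
  assumes "\<And>a b. norm (M $ a $ b) \<le> B"
  shows "norm (matrix_power M k $ a $ b) \<le> (real CARD('v) * B) ^ k"
proof (induction k arbitrary: a b)
  case 0
  show ?case by (simp add: mat_def)
next
  case (Suc k)
  have B: "0 \<le> B" using assms[of a b] norm_ge_zero order_trans by blast
  have "norm (matrix_power M (Suc k) $ a $ b)
      \<le> (\<Sum>c\<in>UNIV. norm (M $ a $ c * matrix_power M k $ c $ b))"
    by (simp add: matrix_matrix_mult_def norm_sum)
  also have "\<dots> \<le> (\<Sum>c\<in>(UNIV :: 'v set). B * (real CARD('v) * B) ^ k)"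
    unfolding norm_mult using assms Suc.IH B by (intro sum_mono mult_mono) auto
  finally show ?case by simp
qed

text \<open>Comparison with the scalar exponential series at \<open>CARD('v) * B\<close>, where
  \<open>B\<close> bounds all entries of \<open>M\<close>. The extra factor \<open>?N * ?N\<close>
  is the price of passing from entries to the norm of the whole matrix.\<close>

lemma summable_matrix_exp:
  fixes M :: "complex^'v^'v"
  shows "summable (\<lambda>k. (1 / fact k) *\<^sub>R matrix_power M k)"
proof -
  obtain B where B: "\<And>a b. norm (M $ a $ b) \<le> B"
    using order_trans[OF Finite_Cartesian_Product.norm_nth_le Finite_Cartesian_Product.norm_nth_le]
    by blast
  let ?N = "real CARD('v)"
  have "norm (matrix_power M k) \<le> ?N * (?N * (?N * B) ^ k)" for k
  proof -
    have "norm (matrix_power M k) \<le> (\<Sum>a\<in>UNIV. \<Sum>b\<in>UNIV. norm (matrix_power M k $ a $ b))"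
      by (intro order_trans[OF norm_vec_le_sum] sum_mono norm_vec_le_sum)
    also have "\<dots> \<le> (\<Sum>a\<in>(UNIV :: 'v set). \<Sum>b\<in>(UNIV :: 'v set). (?N * B) ^ k)"
      by (intro sum_mono norm_matrix_power_entry_le B)
    finally show ?thesis by simp
  qed
  then have "norm ((1 / fact k) *\<^sub>R matrix_power M k) \<le> ?N * ?N * ((?N * B) ^ k /\<^sub>R fact k)" for k
    by (simp add: field_simps)
  moreover have "summable (\<lambda>k. ?N * ?N * ((?N * B) ^ k /\<^sub>R fact k))"
    by (intro summable_mult summable_exp_generic)
  ultimately show ?thesis
    by (blast intro: summable_comparison_test'[where N = 0])
qed

lemma matrix_power_eigenvector:
  fixes M :: "complex^'v^'v"
  assumes "M *v x = c *s x"
  shows "matrix_power M k *v x = c ^ k *s x"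
proof (induction k)
  case (Suc k)
  have "matrix_power M (Suc k) *v x = M *v (c ^ k *s x)"
    by (simp add: Suc.IH flip: matrix_vector_mul_assoc)
  then show ?case
    using assms by (simp add: vector_scalar_commute vector_smult_assoc mult.commute)
qed simp

text \<open>Applying a matrix to the fixed vector \<open>x\<close> is bounded and linear in the
  matrix, so it may be carried out termwise; the series then becomes the scalar exponential series
  multiplied into \<open>x\<close>.\<close>

lemma matrix_exp_eigenvector:
  fixes M :: "complex^'v^'v"
  assumes "M *v x = c *s x"
  shows "matrix_exp M *v x = exp c *s x"
proof -
  have bl: "bounded_linear (\<lambda>A :: complex^'v^'v. A *v x)"
    by (intro linear_conv_bounded_linear[THEN iffD1] linearI)
       (simp_all add: matrix_vector_mult_def vec_eq_iff sum.distrib algebra_simps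
         scaleR_sum_right)
  have bl': "bounded_linear (\<lambda>z. z *s x)"
    by (intro linear_conv_bounded_linear[THEN iffD1] linearI)
       (simp_all add: vec_eq_iff algebra_simps)
  have "(\<lambda>k. (1 / fact k) *\<^sub>R matrix_power M k) sums matrix_exp M"
    unfolding matrix_exp_def by (rule summable_sums[OF summable_matrix_exp])
  then have "(\<lambda>k. ((1 / fact k) *\<^sub>R matrix_power M k) *v x) sums (matrix_exp M *v x)"
    by (rule bounded_linear.sums[OF bl])
  moreover have "((1 / fact k) *\<^sub>R matrix_power M k) *v x = (c ^ k /\<^sub>R fact k) *s x" for k
    using linear_scale[OF bounded_linear.linear[OF bl], of "1 / fact k" "matrix_power M k"]
    by (simp add: matrix_power_eigenvector[OF assms] vec_eq_iff inverse_eq_divide)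
  moreover have "(\<lambda>k. (c ^ k /\<^sub>R fact k) *s x) sums (exp c *s x)"
    by (rule bounded_linear.sums[OF bl' exp_converges])
  ultimately show ?thesis using sums_unique2 by auto
qed

text \<open>The second assumption is the eigenvalue equation of the Laplacian in difference form,
  which keeps degrees out of later computations. A natural number as eigenvalue lets the phase be a
  power of \<open>cis t\<close>.\<close>

lemma transition_matrix_eigenvector:
  fixes \<omega> :: "'v::finite wgraph" and x :: "complex^'v"
  assumes "simple \<omega>"
    and "\<And>a. (\<Sum>b\<in>UNIV. of_real (\<omega> a b) * (x $ a - x $ b)) = of_nat m * x $ a"
  shows "transition_matrix \<omega> t *v x = cis t ^ m *s x"
proof -
  define M :: "complex^'v^'v"
    where "M = (\<chi> a b. \<i> * complex_of_real t * complex_of_real (laplacian \<omega> $ a $ b))"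
  have loop: "\<omega> a a = 0" for a
    using assms(1) by (simp add: simple_def is_edge_def)
  have L: "(\<Sum>b\<in>UNIV. complex_of_real (laplacian \<omega> $ a $ b) * x $ b) = of_nat m * x $ a" for a
  proof -
    have deg: "(\<Sum>c\<in>UNIV - {a}. \<omega> a c) = (\<Sum>c\<in>UNIV. \<omega> a c)"
      by (subst (2) sum.remove[of _ a]) (simp_all add: loop)
    have "complex_of_real (laplacian \<omega> $ a $ b) * x $ b =
        (if b = a then of_real (\<Sum>c\<in>UNIV. \<omega> a c) * x $ a else 0) - of_real (\<omega> a b) * x $ b" for b
      by (auto simp: laplacian_def degree_matrix_def adjacency_matrix_def deg algebra_simps)
    then have "(\<Sum>b\<in>UNIV. complex_of_real (laplacian \<omega> $ a $ b) * x $ b) =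
        (\<Sum>b\<in>UNIV. of_real (\<omega> a b) * (x $ a - x $ b))"
      by (simp add: sum_subtractf sum_distrib_right right_diff_distrib)
    then show ?thesis using assms(2) by simp
  qed
  have "M *v x = (\<i> * of_real t * of_nat m) *s x"
    by (simp add: M_def vec_eq_iff matrix_vector_mult_def mult.assoc L flip: sum_distrib_left)
  then have "matrix_exp M *v x = exp (\<i> * of_real t * of_nat m) *s x"
    by (rule matrix_exp_eigenvector)
  moreover have "exp (\<i> * of_real t * of_nat m) = cis t ^ m"
    by (simp add: cis_conv_exp mult_ac flip: exp_of_nat_mult)
  ultimately show ?thesis by (simp add: transition_matrix_def M_def)
qed

section \<open>The column of the transition matrix at an apex\<close>

lemma sum_UNIV_sum_type:
  "(\<Sum>a\<in>(UNIV :: ('a::finite + 'b::finite) set). f a) = (\<Sum>a\<in>UNIV. f (Inl a)) + (\<Sum>b\<in>UNIV. f (Inr b))"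
  by (simp add: sum.Plus flip: UNIV_Plus_UNIV)

lemma transition_matrix_apex:
  fixes Y :: "'v::finite wgraph"
  assumes "simple Y"
  defines "n \<equiv> CARD('v)"
  shows "transition_matrix (graph_join O2 Y) t *v axis (Inl p) 1 =
    (\<chi> a. case a of
        Inl r \<Rightarrow> (if r = p then cis t ^ n else - (cis t ^ n)) / 2
                  + (2 + of_nat n * cis t ^ (n + 2)) / (2 * (of_nat n + 2))
      | Inr _ \<Rightarrow> (1 - cis t ^ (n + 2)) / (of_nat n + 2))"
proof -
  let ?G = "graph_join O2 Y"
  let ?U = "transition_matrix ?G t"
  define x1 x2 x3 :: "complex^(bool + 'v)" where
    "x1 = (\<chi> a. 1)" and
    "x2 = (\<chi> a. case a of Inl r \<Rightarrow> if r = p then 1 else -1 | Inr _ \<Rightarrow> 0)" and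
    "x3 = (\<chi> a. case a of Inl r \<Rightarrow> of_nat n | Inr _ \<Rightarrow> -2)"
  note xs = x1_def x2_def x3_def
  have simple: "simple ?G"
    using assms(1) by (auto simp: simple_def is_edge_def O2_def split_sum_all)
  have U1: "?U *v x1 = cis t ^ 0 *s x1"
    by (rule transition_matrix_eigenvector[OF simple]) (simp add: x1_def)
  have U2: "?U *v x2 = cis t ^ n *s x2"
  proof (rule transition_matrix_eigenvector[OF simple])
    fix a :: "bool + 'v"
    show "(\<Sum>b\<in>UNIV. of_real (?G a b) * (x2 $ a - x2 $ b)) = of_nat n * x2 $ a"
      by (cases a; cases p) (simp_all add: sum_UNIV_sum_type UNIV_bool O2_def x2_def n_def)
  qed
  have U3: "?U *v x3 = cis t ^ (n + 2) *s x3"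
  proof (rule transition_matrix_eigenvector[OF simple])
    fix a :: "bool + 'v"
    show "(\<Sum>b\<in>UNIV. of_real (?G a b) * (x3 $ a - x3 $ b)) = of_nat (n + 2) * x3 $ a"
      by (cases a) (simp_all add: sum_UNIV_sum_type UNIV_bool O2_def x3_def n_def algebra_simps)
  qed
  \<comment> \<open>Writing everything in \<open>d = n + 2\<close> leaves a single denominator,
    known to be nonzero, to clear.\<close>
  define d :: complex where "d = of_nat n + 2"
  have d: "d \<noteq> 0" and n_eq: "of_nat n = d - 2"
    using of_nat_neq_0[of "n + 1", where 'a = complex] by (simp_all add: d_def add_ac)
  \<comment> \<open>\<open>x2 / 2\<close> is the antisymmetric half of the apex vector. The
    symmetric half comes from \<open>2 * x1 + x3\<close>, which equals \<open>n + 2\<close> on both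
    apexes and vanishes on \<open>Y\<close>.\<close>
  have "axis (Inl p) 1 = (1 / 2) *s x2 + (1 / (of_nat n + 2)) *s x1 + (1 / (2 * (of_nat n + 2))) *s x3"
    using d by (auto simp: vec_eq_iff axis_def xs n_eq field_simps split: sum.split)
  then have column: "?U *v axis (Inl p) 1 = (1 / 2) *s (cis t ^ n *s x2)
      + (1 / (of_nat n + 2)) *s (cis t ^ 0 *s x1)
      + (1 / (2 * (of_nat n + 2))) *s (cis t ^ (n + 2) *s x3)"
    by (simp only: matrix_vector_right_distrib vector_scalar_commute U1 U2 U3)
  show ?thesis
    unfolding column using d by (auto simp: vec_eq_iff xs n_eq field_simps split: sum.split)
qed

section \<open>Revival and state transfer as equations in \<open>cis t\<close>\<close>

text \<open>The entries on \<open>Y\<close> vanish exactly when \<open>cis t ^ (n + 2) = 1\<close>,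
  and under this condition the two apex entries simplify to the stated coefficients. Apexes are
  indexed by booleans, so \<open>\<not> p\<close> is the other one.\<close>

lemma fractional_revival_apexes_iff:
  fixes Y :: "'v::finite wgraph"
  assumes "simple Y"
  defines "n \<equiv> CARD('v)"
  shows "fractional_revival (graph_join O2 Y) \<alpha> \<beta> (Inl p) (Inl (\<not> p)) t \<longleftrightarrow>
    cis t ^ (n + 2) = 1 \<and> \<alpha> = (1 + cis t ^ n) / 2 \<and> \<beta> = (1 - cis t ^ n) / 2"
proof -
  define z w where "z = cis t ^ n" and "w = cis t ^ (n + 2)"
  define c :: complex where "c = (2 + of_nat n * w) / (2 * (of_nat n + 2))"
  have nz: "of_nat n + 2 \<noteq> (0 :: complex)" "4 + of_nat n * 2 \<noteq> (0 :: complex)"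
    using of_nat_neq_0[of "n + 1", where 'a = complex]
      of_nat_neq_0[of "2 * n + 3", where 'a = complex] by (simp_all add: algebra_simps)
  have "fractional_revival (graph_join O2 Y) \<alpha> \<beta> (Inl p) (Inl (\<not> p)) t \<longleftrightarrow>
      z / 2 + c = \<alpha> \<and> - z / 2 + c = \<beta> \<and> (1 - w) / (of_nat n + 2) = 0"
    unfolding fractional_revival_def transition_matrix_apex[OF assms(1)]
    by (cases p) (simp_all add: vec_eq_iff axis_def split_sum_all all_bool_eq c_def z_def w_def n_def
      conj_ac)
  also have "\<dots> \<longleftrightarrow> w = 1 \<and> \<alpha> = (1 + z) / 2 \<and> \<beta> = (1 - z) / 2"
  proof (cases "w = 1")
    case True
    then have "c = 1 / 2" using nz by (simp add: c_def divide_simps) (simp add: algebra_simps)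
    then show ?thesis using True by (auto simp: field_simps)
  next
    case False
    then show ?thesis using nz by simp
  qed
  finally show ?thesis unfolding z_def w_def .
qed

lemma unit_complex_eq_one:
  fixes w :: complex
  assumes "norm w = 1" and "Re w \<ge> 1"
  shows "w = 1"
  using assms abs_Re_le_cmod[of w] cmod_power2[of w] by (auto simp: complex_eq_iff)

text \<open>The entry is \<open>(c - z) / 2\<close> with \<open>z\<close> on the unit circle and
  \<open>c\<close> a convex combination of \<open>1\<close> and \<open>w\<close>. Modulus one forces
  equality in the triangle inequality twice: first \<open>w = 1\<close>, hence \<open>c = 1\<close>,
  and then \<open>z = -1\<close>.\<close>

lemma perfect_state_transfer_apexes_iff:
  fixes Y :: "'v::finite wgraph"
  assumes "simple Y"
  defines "n \<equiv> CARD('v)"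
  shows "perfect_state_transfer (graph_join O2 Y) (Inl p) (Inl (\<not> p)) t \<longleftrightarrow>
    cis t ^ (n + 2) = 1 \<and> cis t ^ 2 = -1"
proof -
  define z w where "z = cis t ^ n" and "w = cis t ^ (n + 2)"
  define c where "c = (2 + of_nat n * w) / (of_nat n + 2)"
  have wz: "w = z * cis t ^ 2" by (simp add: w_def z_def power2_eq_square)
  have norms: "norm z = 1" "norm w = 1" by (simp_all add: z_def w_def norm_mult norm_power)
  have n: "n > 0" by (simp add: n_def)
  have npos: "norm (of_nat n + 2 :: complex) = real n + 2"
    by (metis norm_of_nat of_nat_add of_nat_numeral)
  then have nz: "of_nat n + 2 \<noteq> (0 :: complex)" by auto
  have "transition_matrix (graph_join O2 Y) t $ Inl p $ Inl (\<not> p)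
      = (transition_matrix (graph_join O2 Y) t *v axis (Inl (\<not> p)) 1) $ Inl p"
    by (simp add: matrix_vector_mult_def axis_def if_distrib[of "(*) _"] cong: if_cong)
  also have "\<dots> = (c - z) / 2"
    unfolding transition_matrix_apex[OF assms(1)]
    by (simp add: z_def w_def c_def n_def diff_divide_distrib mult.commute)
  finally have entry: "transition_matrix (graph_join O2 Y) t $ Inl p $ Inl (\<not> p) = (c - z) / 2" .
  have "perfect_state_transfer (graph_join O2 Y) (Inl p) (Inl (\<not> p)) t \<longleftrightarrow>
      norm (c - z) = 2"
    unfolding perfect_state_transfer_def entry by (simp add: norm_divide)
  also have "\<dots> \<longleftrightarrow> w = 1 \<and> z = -1"
  proof
    assume 2: "norm (c - z) = 2"
    then have "norm c \<ge> 1" using norm_triangle_ineq4[of c z] norms by simp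
    then have "norm (2 + of_nat n * w) \<ge> real n + 2"
      by (simp add: c_def norm_divide npos field_simps)
    then have "(real n + 2)\<^sup>2 \<le> (norm (2 + of_nat n * w))\<^sup>2" by (intro power_mono) auto
    also have "\<dots> = 4 + 4 * real n * Re w + (real n)\<^sup>2 * ((Re w)\<^sup>2 + (Im w)\<^sup>2)"
      by (simp only: cmod_power2) (simp add: power2_eq_square algebra_simps)
    also have "(Re w)\<^sup>2 + (Im w)\<^sup>2 = 1" using norms(2) cmod_power2[of w] by simp
    \<comment> \<open>After cancellation the inequality reads
      \<open>4 * n \<le> 4 * n * Re w\<close>, and \<open>Y\<close> has at least one vertex.\<close>
    finally have "Re w \<ge> 1" using n by (simp add: power2_eq_square algebra_simps)
    then have w: "w = 1" using norms unit_complex_eq_one by blast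
    then have "norm (1 - z) = 2" using 2 nz by (simp add: c_def add.commute)
    then have "(1 - Re z)\<^sup>2 + (Im z)\<^sup>2 = 4" using cmod_power2[of "1 - z"] by simp
    moreover have "(Re z)\<^sup>2 + (Im z)\<^sup>2 = 1" using norms(1) cmod_power2[of z] by simp
    ultimately have "Re (- z) \<ge> 1" by (simp add: power2_eq_square algebra_simps)
    then have "- z = 1" using norms unit_complex_eq_one[of "- z"] by simp
    with w show "w = 1 \<and> z = -1" by (simp add: minus_equation_iff)
  next
    assume "w = 1 \<and> z = -1"
    then show "norm (c - z) = 2" using nz by (simp add: c_def add.commute)
  qed
  also have "\<dots> \<longleftrightarrow> w = 1 \<and> cis t ^ 2 = -1"
    using wz by (auto simp: minus_equation_iff)
  finally show ?thesis unfolding w_def .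
qed

text \<open>A point \<open>z\<close> of the unit circle is equidistant from \<open>1\<close> and
  \<open>-1\<close> iff \<open>z\<close> is \<open>\<i>\<close> or \<open>-\<i>\<close>, that is,
  iff its square is \<open>-1\<close>. The revival condition makes the product of
  \<open>z\<^sup>2\<close> and \<open>cis t ^ 4\<close> equal to \<open>1\<close>, so one factor is
  \<open>-1\<close> iff the other is.\<close>

lemma balanced_fractional_revival_apexes_iff:
  fixes Y :: "'v::finite wgraph"
  assumes "simple Y"
  defines "n \<equiv> CARD('v)"
  shows "balanced_fractional_revival (graph_join O2 Y) (Inl p) (Inl (\<not> p)) t \<longleftrightarrow>
    cis t ^ (n + 2) = 1 \<and> cis t ^ 4 = -1"
proof -
  define z where "z = cis t ^ n"
  have "(norm z)\<^sup>2 = 1" by (simp add: z_def norm_power)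
  then have unit: "(Re z)\<^sup>2 + (Im z)\<^sup>2 = 1" by (simp add: cmod_power2)
  have "norm ((1 + z) / 2) = norm ((1 - z) / 2) \<longleftrightarrow> (norm (1 + z))\<^sup>2 = (norm (1 - z))\<^sup>2"
    by (simp add: norm_divide)
  also have "\<dots> \<longleftrightarrow> Re z = 0"
    by (simp only: cmod_power2) (auto simp: power2_eq_square algebra_simps)
  also have "\<dots> \<longleftrightarrow> z\<^sup>2 = -1"
    using unit by (auto simp: complex_eq_iff power2_eq_square)
  finally have "balanced_fractional_revival (graph_join O2 Y) (Inl p) (Inl (\<not> p)) t \<longleftrightarrow>
      cis t ^ (n + 2) = 1 \<and> z\<^sup>2 = -1"
    unfolding balanced_fractional_revival_def fractional_revival_apexes_iff[OF assms(1)]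
      z_def n_def by blast
  moreover have "z\<^sup>2 * cis t ^ 4 = (cis t ^ (n + 2))\<^sup>2"
    by (simp only: z_def power_mult[symmetric] power_add[symmetric] add_mult_distrib) simp
  then have "z\<^sup>2 = -1 \<longleftrightarrow> cis t ^ 4 = -1" if "cis t ^ (n + 2) = 1"
    using that by (auto simp: minus_equation_iff)
  ultimately show ?thesis by blast
qed

text \<open>Write \<open>N = 2 ^ j * r\<close> with \<open>r\<close> odd. If
  \<open>j \<le> k\<close>, then \<open>2 ^ k * r\<close> is a multiple of \<open>N\<close>, so
  raising \<open>q\<close> to it gives \<open>1\<close>, whereas the first assumption gives
  \<open>(-1) ^ r = -1\<close>.\<close>

lemma power_two_dvd_exponent:
  fixes q :: complex
  assumes "q ^ (2 ^ k) = -1" and "q ^ N = 1"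
  shows "2 ^ Suc k dvd N"
proof (cases "N = 0")
  case False
  then obtain r where N: "N = 2 ^ multiplicity 2 N * r" and r: "odd r"
    using multiplicity_decompose'[of N 2] by (metis odd_one)
  define j where "j = multiplicity 2 N"
  have "Suc k \<le> j"
  proof (rule ccontr)
    assume "\<not> Suc k \<le> j"
    then have "2 ^ k * r = N * 2 ^ (k - j)"
      by (subst N) (simp add: j_def mult_ac flip: power_add)
    then have "(q ^ (2 ^ k)) ^ r = (q ^ N) ^ (2 ^ (k - j))"
      by (simp only: flip: power_mult)
    then show False using assms r by simp
  qed
  then show ?thesis
    using N le_imp_power_dvd[of "Suc k" j 2] unfolding j_def by (metis dvd_mult2)
qed simp

section \<open>Explicit revival times and the cases modulo 4\<close>

theorem theorem6p2:
  fixes Y :: "'v::finite wgraph" and u v :: "bool + 'v" and n :: nat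
  assumes "undirected Y" and "simple Y" and "positively_weighted Y"
    and "n = CARD('v)"
    and "{u, v} = range Inl"
  shows
    "(\<forall>k::nat. k > 0 \<longrightarrow> \<not> (n + 2) dvd 2 * k \<longrightarrow>
       (let \<tau> = 2 * real k * pi / (real n + 2);
            \<gamma> = 2 * real k * pi / (real n + 2);
            \<zeta> = 2 * real k * (real n + 1) * pi / (real n + 2)
        in proper_fractional_revival (graph_join O2 Y)
             (exp (\<i> * complex_of_real \<zeta>) * complex_of_real (cos \<gamma>))
             (\<i> * exp (\<i> * complex_of_real \<zeta>) * complex_of_real (sin \<gamma>)) u v \<tau>)) \<and>
     (odd n \<or> n mod 4 = 0 \<longrightarrow>
       \<not> (\<exists>\<tau>. perfect_state_transfer (graph_join O2 Y) u v \<tau>) \<and>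
       \<not> (\<exists>\<tau>. balanced_fractional_revival (graph_join O2 Y) u v \<tau>)) \<and>
     (n mod 4 = 2 \<longrightarrow>
       perfect_state_transfer (graph_join O2 Y) u v (pi / 2) \<and>
       (\<forall>\<tau>>0. perfect_state_transfer (graph_join O2 Y) u v \<tau> \<longrightarrow> pi / 2 \<le> \<tau>) \<and>
       ((\<exists>\<tau>. balanced_fractional_revival (graph_join O2 Y) u v \<tau>) \<longleftrightarrow>
         multiplicity 2 (n + 2) \<ge> 3))"
proof -
  have simple: "simple Y" by fact
  \<comment> \<open>The assumption on \<open>{u, v}\<close> leaves open which apex is called
    \<open>u\<close>; \<open>p\<close> records the choice.\<close>
  obtain p where uv: "u = Inl p" "v = Inl (\<not> p)"
    using assms(5) by (auto simp: UNIV_bool doubleton_eq_iff)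
  note FR = fractional_revival_apexes_iff[OF simple, folded assms(4)]
  note PST = perfect_state_transfer_apexes_iff[OF simple, folded assms(4)]
  note BFR = balanced_fractional_revival_apexes_iff[OF simple, folded assms(4)]
  have revival: "proper_fractional_revival (graph_join O2 Y)
      (exp (\<i> * complex_of_real (2 * real k * (real n + 1) * pi / (real n + 2))) * complex_of_real (cos \<gamma>))
      (\<i> * exp (\<i> * complex_of_real (2 * real k * (real n + 1) * pi / (real n + 2))) * complex_of_real (sin \<gamma>))
      u v \<gamma>"
    if "\<not> (n + 2) dvd 2 * k" and \<gamma>: "\<gamma> = 2 * real k * pi / (real n + 2)" for k :: nat and \<gamma> :: real
  proof -
    have period: "real (n + 2) * \<gamma> = 2 * pi * real k"
      unfolding \<gamma> by (simp add: field_simps)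
    have full: "cis (2 * pi * real k) = 1" by (intro cis_multiple_2pi) simp
    \<comment> \<open>The phase \<zeta> differs from -\<gamma> by a multiple of the full
      turn.\<close>
    have "2 * real k * (real n + 1) * pi / (real n + 2) = 2 * pi * real k - \<gamma>"
      unfolding \<gamma> by (simp add: field_simps)
    then have \<zeta>: "exp (\<i> * complex_of_real (2 * real k * (real n + 1) * pi / (real n + 2))) = cis (- \<gamma>)"
      by (simp only: cis_conv_exp[symmetric] cis_divide[symmetric] full) (simp add: cis_inverse divide_inverse)
    have "real n * \<gamma> = 2 * pi * real k - 2 * \<gamma>" using period by (simp add: algebra_simps)
    then have "cis \<gamma> ^ n = cis (2 * pi * real k) / cis (2 * \<gamma>)"
      by (simp only: Complex.DeMoivre cis_divide)
    then have z: "cis \<gamma> ^ n = cis (- (2 * \<gamma>))"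
      by (simp only: full) (simp add: cis_inverse divide_inverse)
    have w: "cis \<gamma> ^ (n + 2) = 1" by (simp only: Complex.DeMoivre period full)
    \<comment> \<open>Properness: a zero of the sine would make \<gamma> an integer multiple of
      \<open>pi\<close>, hence \<open>2 * k\<close> a multiple of \<open>n + 2\<close>.\<close>
    have "sin \<gamma> \<noteq> 0"
    proof
      assume "sin \<gamma> = 0"
      then obtain i :: int where "\<gamma> = of_int i * pi" by (auto simp: sin_zero_iff_int2)
      then have "pi * (2 * real k) = pi * (real_of_int i * (real n + 2))"
        by (simp add: \<gamma> field_simps)
      then have "2 * real k = real_of_int i * (real n + 2)" by (simp only: mult_cancel_left) simp
      then have "real_of_int (int (2 * k)) = real_of_int (i * int (n + 2))" by simp
      then have "int (2 * k) = i * int (n + 2)" by (simp only: of_int_eq_iff)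
      then have "int (n + 2) dvd int (2 * k)" by (metis dvd_triv_right)
      then show False using that(1) by (simp only: int_dvd_int_iff)
    qed
    \<comment> \<open>Euler's formulas for cosine and sine, multiplied by
      \<open>cis (- \<gamma>)\<close>, match the coefficients required by \<open>FR\<close>.\<close>
    moreover have "cis (- \<gamma>) * complex_of_real (cos \<gamma>) = (1 + cis (- (2 * \<gamma>))) / 2"
      by (simp add: complex_eq_iff cos_double_cos sin_double power2_eq_square)
    moreover have "\<i> * cis (- \<gamma>) * complex_of_real (sin \<gamma>) = (1 - cis (- (2 * \<gamma>))) / 2"
      by (simp add: complex_eq_iff cos_double_sin sin_double power2_eq_square)
    ultimately show ?thesis
      unfolding proper_fractional_revival_def uv FR \<zeta> z using w by simp
  qed
  have dvd4: "4 dvd n + 2" if "perfect_state_transfer (graph_join O2 Y) u v t" for t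
    using power_two_dvd_exponent[of "cis t" 1 "n + 2"] that unfolding uv PST by simp
  have dvd8: "8 dvd n + 2" if "balanced_fractional_revival (graph_join O2 Y) u v t" for t
    using power_two_dvd_exponent[of "cis t" 2 "n + 2"] that unfolding uv BFR by simp
  have pst: "perfect_state_transfer (graph_join O2 Y) u v (pi / 2)" if d: "4 dvd n + 2"
  proof -
    obtain m where "n + 2 = 4 * m" using d by (rule dvdE)
    then show ?thesis unfolding uv PST by (simp add: power_mult)
  qed
  have pst_min: "pi / 2 \<le> t" if "t > 0" "perfect_state_transfer (graph_join O2 Y) u v t" for t
  proof (rule ccontr)
    assume "\<not> pi / 2 \<le> t"
    \<comment> \<open>For \<open>t\<close> strictly between \<open>0\<close> and
      \<open>pi / 2\<close> the number \<open>cis (2 * t)\<close> has positive imaginary part, so it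
      cannot be \<open>-1\<close>.\<close>
    then have "sin (2 * t) > 0" using that(1) by (intro sin_gt_zero) auto
    moreover have "cis (2 * t) = -1" using that(2) unfolding uv PST by (simp add: Complex.DeMoivre)
    ultimately show False by (simp add: complex_eq_iff)
  qed
  \<comment> \<open>At \<open>pi / 4\<close> the base \<open>cis t\<close> is a primitive eighth
    root of unity, so its fourth power is \<open>-1\<close> and its power \<open>n + 2\<close> is
    \<open>1\<close>.\<close>
  have bfr: "balanced_fractional_revival (graph_join O2 Y) u v (pi / 4)" if d: "8 dvd n + 2"
  proof -
    obtain m where "n + 2 = 8 * m" using d by (rule dvdE)
    moreover have q4: "cis (pi / 4) ^ 4 = -1" by (simp add: Complex.DeMoivre)
    moreover have "cis (pi / 4) ^ 8 = 1" using power_mult[of "cis (pi / 4)" 4 2] by (simp add: q4)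
    ultimately show ?thesis unfolding uv BFR by (simp add: power_mult)
  qed
  have mult8: "multiplicity 2 (n + 2) \<ge> 3 \<longleftrightarrow> 8 dvd n + 2"
    using power_dvd_iff_le_multiplicity[of "n + 2" 2 3] by simp
  have no_dvd: "\<not> 4 dvd n + 2 \<and> \<not> 8 dvd n + 2" if "odd n \<or> n mod 4 = 0"
    using that by presburger
  have dvd: "4 dvd n + 2" if "n mod 4 = 2" using that by presburger
  have "\<nexists>t. perfect_state_transfer (graph_join O2 Y) u v t"
    "\<nexists>t. balanced_fractional_revival (graph_join O2 Y) u v t" if "odd n \<or> n mod 4 = 0"
    using no_dvd[OF that] dvd4 dvd8 by auto
  moreover have "(\<exists>t. balanced_fractional_revival (graph_join O2 Y) u v t) \<longleftrightarrow> 8 dvd n + 2"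
    using dvd8 bfr by auto
  ultimately show ?thesis
    unfolding Let_def mult8
    by (intro conjI allI impI revival[OF _ refl] pst pst_min dvd) simp_all
qed

end
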